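(* Let $G$ be a finite nonabelian group. Then $G$ is nested if and only if for all elements $g, h \in G \setminus Z(G)$, either $[g,G] \le [h,G]$ or $[h,G] \le [g,G]$.
   Context: $\mathrm{Irr}(G)$ denotes the set of irreducible complex characters of the finite group $G$. For $\chi \in \mathrm{Irr}(G)$, the center $Z(\chi)$ of $\chi$ is the subgroup of $G$ containing $\ker(\chi)$ determined by $Z(\chi)/\ker(\chi) = Z(G/\ker(\chi))$ (equivalently, $Z(\chi) = \{g \in G : |\chi(g)| = \chi(1)\}$). The group $G$ is called nested if for all $\chi, \psi \in \mathrm{Irr}(G)$ either $Z(\chi) \le Z(\psi)$ or $Z(\psi) \le Z(\chi)$. For $g \in G$, set $\gamma_G(g) = \{[g,x] : x \in G\}$, where $[g,x] = g^{-1}x^{-1}gx$, and let $[g,G]$ denote the subgroup of $G$ generated by $\gamma_G(g)$. $Z(G)$ is the center of $G$. *)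

theory Defs
  imports
    "HOL-Algebra.Coset"
    "HOL-Algebra.Generated_Groups"
    "Jordan_Normal_Form.VS_Connect"
begin

definition center :: "('a, 'b) monoid_scheme \<Rightarrow> 'a set" where
  "center G = {z \<in> carrier G. \<forall>x \<in> carrier G. z \<otimes>\<^bsub>G\<^esub> x = x \<otimes>\<^bsub>G\<^esub> z}"

definition GL :: "nat \<Rightarrow> complex mat monoid" where
  "GL n = units_of (ring_mat TYPE(complex) n ())"

definition trace_mat :: "'a :: comm_monoid_add mat \<Rightarrow> 'a" where
  "trace_mat A = (\<Sum>i < dim_row A. A $$ (i, i))"

definition representation ::
  "('a, 'b) monoid_scheme \<Rightarrow> nat \<Rightarrow> ('a \<Rightarrow> complex mat) \<Rightarrow> bool" where
  "representation G n \<rho> \<longleftrightarrow> \<rho> \<in> hom G (GL n)"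

definition invariant_subspace ::
  "('a, 'b) monoid_scheme \<Rightarrow> nat \<Rightarrow> ('a \<Rightarrow> complex mat) \<Rightarrow> complex vec set \<Rightarrow> bool" where
  "invariant_subspace G n \<rho> W \<longleftrightarrow>
     VectorSpace.subspace class_ring W (module_vec TYPE(complex) n) \<and>
     (\<forall>g \<in> carrier G. \<forall>w \<in> W. \<rho> g *\<^sub>v w \<in> W)"

definition irreducible_representation ::
  "('a, 'b) monoid_scheme \<Rightarrow> nat \<Rightarrow> ('a \<Rightarrow> complex mat) \<Rightarrow> bool" where
  "irreducible_representation G n \<rho> \<longleftrightarrow>
     representation G n \<rho> \<and> 0 < n \<and>
     (\<forall>W. invariant_subspace G n \<rho> W \<longrightarrow> W = {0\<^sub>v n} \<or> W = carrier_vec n)"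

text \<open>Characters are made extensional on the carrier, so that equality in
  \<open>Irr G\<close> is equality of functions on the group.\<close>

definition character ::
  "('a, 'b) monoid_scheme \<Rightarrow> ('a \<Rightarrow> complex mat) \<Rightarrow> 'a \<Rightarrow> complex" where
  "character G \<rho> = (\<lambda>g \<in> carrier G. trace_mat (\<rho> g))"

definition Irr :: "('a, 'b) monoid_scheme \<Rightarrow> ('a \<Rightarrow> complex) set" where
  "Irr G = {character G \<rho> | n \<rho>. irreducible_representation G n \<rho>}"

definition char_kernel :: "('a, 'b) monoid_scheme \<Rightarrow> ('a \<Rightarrow> complex) \<Rightarrow> 'a set" where
  "char_kernel G \<chi> = {g \<in> carrier G. \<chi> g = \<chi> \<one>\<^bsub>G\<^esub>}"

text \<open>The full preimage in \<open>G\<close> of the center of the quotient by the kernel of \<open>\<chi>\<close>.\<close>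

definition char_center :: "('a, 'b) monoid_scheme \<Rightarrow> ('a \<Rightarrow> complex) \<Rightarrow> 'a set" where
  "char_center G \<chi> =
     {g \<in> carrier G. char_kernel G \<chi> #>\<^bsub>G\<^esub> g \<in> center (G Mod char_kernel G \<chi>)}"

definition nested :: "('a, 'b) monoid_scheme \<Rightarrow> bool" where
  "nested G \<longleftrightarrow>
     (\<forall>\<chi> \<in> Irr G. \<forall>\<psi> \<in> Irr G.
        char_center G \<chi> \<subseteq> char_center G \<psi> \<or> char_center G \<psi> \<subseteq> char_center G \<chi>)"

definition commutator :: "('a, 'b) monoid_scheme \<Rightarrow> 'a \<Rightarrow> 'a \<Rightarrow> 'a" where
  "commutator G g x = inv\<^bsub>G\<^esub> g \<otimes>\<^bsub>G\<^esub> inv\<^bsub>G\<^esub> x \<otimes>\<^bsub>G\<^esub> g \<otimes>\<^bsub>G\<^esub> x"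

definition commutator_set :: "('a, 'b) monoid_scheme \<Rightarrow> 'a \<Rightarrow> 'a set" where
  "commutator_set G g = {commutator G g x | x. x \<in> carrier G}"

definition commutator_subgroup :: "('a, 'b) monoid_scheme \<Rightarrow> 'a \<Rightarrow> 'a set" where
  "commutator_subgroup G g = generate G (commutator_set G g)"

end

theory Submission
  imports
    Defs
    "Jordan_Normal_Form.Schur_Decomposition"
    "Jordan_Normal_Form.DL_Rank"
    "HOL-Algebra.Multiplicative_Group"
begin

text \<open>
  An element \<open>g\<close> lies in \<open>Z(\<chi>)\<close> iff \<open>[g,G] \<le> ker \<chi>\<close>, so a chain of commutator subgroups makes the
  centers of characters comparable. Conversely, \<open>[g,G]\<close> is normal, and a normal subgroup is the
  intersection of the kernels of the irreducible characters trivial on it; so if \<open>[h,G]\<close> is not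
  contained in \<open>[g,G]\<close>, some \<open>\<chi>\<close> has \<open>g \<in> Z(\<chi>)\<close> and \<open>h \<notin> Z(\<chi>)\<close>. An irreducible character
  trivial on a normal subgroup \<open>N\<close> but not at \<open>x \<notin> N\<close> comes from a representation of least degree
  with that property (one exists: the regular representation of \<open>G/N\<close>), and no complete
  reducibility is needed. In both places the analytic input is that a complex matrix of finite
  order whose trace equals its size is the identity.
\<close>

section \<open>Matrices of finite order\<close>

lemma trace_mat_carrier: "A \<in> carrier_mat n n \<Longrightarrow> trace_mat A = (\<Sum>i<n. A $$ (i, i))"
  by (auto simp: trace_mat_def)

lemma trace_mat_mult_commute:
  fixes A B :: "'a :: comm_semiring_0 mat"
  assumes A: "A \<in> carrier_mat n m" and B: "B \<in> carrier_mat m n"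
  shows "trace_mat (A * B) = trace_mat (B * A)"
proof -
  have "trace_mat (A * B) = (\<Sum>i<n. \<Sum>j<m. A $$ (i, j) * B $$ (j, i))"
    using A B by (auto simp: trace_mat_def scalar_prod_def lessThan_atLeast0 intro!: sum.cong)
  also have "\<dots> = (\<Sum>j<m. \<Sum>i<n. B $$ (j, i) * A $$ (i, j))"
    by (subst sum.swap) (simp add: mult.commute)
  also have "\<dots> = trace_mat (B * A)"
    using A B by (auto simp: trace_mat_def scalar_prod_def lessThan_atLeast0 intro!: sum.cong)
  finally show ?thesis .
qed

text \<open>With \<open>A = P * (B * Q)\<close>, cyclicity of the trace moves \<open>P\<close> to
  the right, where \<open>Q * P\<close> is the identity. It lets the trace of a matrix be read off a
  triangular form.\<close>

lemma trace_mat_similar: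
  fixes A B :: "'a :: comm_ring_1 mat"
  assumes "similar_mat_wit A B P Q"
  shows "trace_mat A = trace_mat B"
proof -
  define n where "n = dim_row A"
  note sim = similar_mat_witD[OF n_def assms]
  have "trace_mat A = trace_mat (P * (B * Q))"
    using sim by (simp add: assoc_mult_mat[of _ n n _ n _ n])
  also have "\<dots> = trace_mat (B * Q * P)"
    using sim by (intro trace_mat_mult_commute[of _ n n]) auto
  also have "B * Q * P = B"
    using sim by (simp add: assoc_mult_mat[of _ n n _ n _ n])
  finally show ?thesis .
qed

text \<open>The term \<open>A $$ (i, l) * B $$ (l, j)\<close> vanishes unless i \<le> l \<le> j. No
  such \<open>l\<close> exists below the diagonal, and on the diagonal only \<open>l = i\<close>
  survives.\<close>

lemma upper_triangular_mult:
  fixes A B :: "'a :: semiring_0 mat"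
  assumes A: "A \<in> carrier_mat n n" "upper_triangular A"
    and B: "B \<in> carrier_mat n n" "upper_triangular B"
  shows "upper_triangular (A * B)"
    and "i < n \<Longrightarrow> (A * B) $$ (i, i) = A $$ (i, i) * B $$ (i, i)"
proof -
  have entry: "(A * B) $$ (i, j) = (\<Sum>l = 0..<n. A $$ (i, l) * B $$ (l, j))"
    if "i < n" "j < n" for i j
    using that A B by (auto simp: scalar_prod_def intro!: sum.cong)
  have zero: "A $$ (i, l) * B $$ (l, j) = 0" if "i < n" "l < n" "l < i \<or> j < l" for i j l
    using that upper_triangularD[OF A(2), of l i] upper_triangularD[OF B(2), of j l] A B by auto
  show "upper_triangular (A * B)"
  proof
    fix i j assume "j < i" "i < dim_row (A * B)"
    then have ij: "j < i" "i < n" "j < n" using A by auto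
    show "(A * B) $$ (i, j) = 0"
      unfolding entry[OF ij(2,3)] using ij by (intro sum.neutral ballI zero) auto
  qed
  show "(A * B) $$ (i, i) = A $$ (i, i) * B $$ (i, i)" if "i < n"
  proof -
    have "(\<Sum>l = 0..<n. A $$ (i, l) * B $$ (l, i)) = (\<Sum>l \<in> {i}. A $$ (i, l) * B $$ (l, i))"
      using that zero[of i _ i] by (intro sum.mono_neutral_right) (auto, metis linorder_neqE_nat)
    then show ?thesis unfolding entry[OF that that] by simp
  qed
qed

lemma upper_triangular_pow:
  fixes A :: "'a :: semiring_1 mat"
  assumes "A \<in> carrier_mat n n" "upper_triangular A"
  shows "upper_triangular (A ^\<^sub>m k) \<and> (\<forall>i<n. (A ^\<^sub>m k) $$ (i, i) = A $$ (i, i) ^ k)"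
proof (induction k)
  case 0
  then show ?case using assms by auto
next
  case (Suc k)
  then show ?case
    using upper_triangular_mult[OF pow_carrier_mat[OF assms(1)] _ assms, of k]
    by (simp add: power_commutes)
qed

text \<open>Since \<open>B ^\<^sub>m m - 1\<^sub>m n\<close> is zero and factors as a geometric sum
  times \<open>B - 1\<^sub>m n\<close>, the second factor vanishes once the first is invertible,
  which holds because \<open>m\<close> is nonzero in characteristic 0.\<close>

lemma unitriangular_pow_eq_one:
  fixes B :: "complex mat"
  assumes B: "B \<in> carrier_mat n n" "upper_triangular B"
    and diag: "\<And>i. i < n \<Longrightarrow> B $$ (i, i) = 1"
    and "B ^\<^sub>m m = 1\<^sub>m n" "m > 0"
  shows "B = 1\<^sub>m n"
proof -
  \<comment> \<open>The geometric sum \<open>S = 1 + B + \<dots> + B ^ (m - 1)\<close> is triangular with diagonal entries \<open>m\<close>,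
    hence invertible.\<close>
  have "\<exists>S \<in> carrier_mat n n. upper_triangular S \<and> (\<forall>i<n. S $$ (i, i) = of_nat k) \<and>
      S * (B - 1\<^sub>m n) = B ^\<^sub>m k - 1\<^sub>m n" for k
  proof (induction k)
    case 0
    show ?case using B by (intro bexI[of _ "0\<^sub>m n n"]) auto
  next
    case (Suc k)
    then obtain S where S: "S \<in> carrier_mat n n" "upper_triangular S"
      "\<And>i. i < n \<Longrightarrow> S $$ (i, i) = of_nat k" "S * (B - 1\<^sub>m n) = B ^\<^sub>m k - 1\<^sub>m n"
      by blast
    define C where "C = B ^\<^sub>m k"
    have C: "C \<in> carrier_mat n n" using B by (simp add: C_def pow_carrier_mat)
    have Ct: "upper_triangular C" "\<And>i. i < n \<Longrightarrow> C $$ (i, i) = 1"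
      using upper_triangular_pow[OF B, of k] diag by (auto simp: C_def)
    \<comment> \<open>Adding the next power \<open>C\<close> to the sum telescopes the product, and
      raises each diagonal entry from \<open>k\<close> to \<open>k + 1\<close>.\<close>
    have "(S + C) * (B - 1\<^sub>m n) = S * (B - 1\<^sub>m n) + C * (B - 1\<^sub>m n)"
      using S B C by (intro add_mult_distrib_mat[of _ n n _ _ n]) auto
    also have "C * (B - 1\<^sub>m n) = C * B - C"
      using mult_minus_distrib_mat[OF C B(1), of "1\<^sub>m n"] C by simp
    also have "S * (B - 1\<^sub>m n) + (C * B - C) = C * B - 1\<^sub>m n"
      unfolding S(4) C_def[symmetric] using B C by (intro eq_matI) auto
    finally have "(S + C) * (B - 1\<^sub>m n) = B ^\<^sub>m Suc k - 1\<^sub>m n"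
      by (simp add: C_def)
    moreover have "upper_triangular (S + C)"
      using S C upper_triangularD[OF S(2)] upper_triangularD[OF Ct(1)]
      by (auto simp: upper_triangular_def)
    ultimately show ?case
      using S C Ct by (intro bexI[of _ "S + C"]) auto
  qed
  then obtain S where S: "S \<in> carrier_mat n n" "upper_triangular S"
    "\<And>i. i < n \<Longrightarrow> S $$ (i, i) = of_nat m" "S * (B - 1\<^sub>m n) = B ^\<^sub>m m - 1\<^sub>m n"
    by blast
  \<comment> \<open>The determinant is the product of \<open>n\<close> diagonal entries equal to
    \<open>m\<close>, hence nonzero.\<close>
  have "det S = (\<Prod>x\<leftarrow>diag_mat S. x)" using S by (simp add: det_upper_triangular)
  also have "diag_mat S = replicate n (of_nat m)"
    using S by (auto simp: diag_mat_def intro!: nth_equalityI)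
  finally have "det S \<noteq> 0" using \<open>m > 0\<close> by (simp add: prod_list_replicate)
  from det_non_zero_imp_unit[OF S(1) this] obtain T where
    T: "T \<in> carrier_mat n n" "T * S = 1\<^sub>m n"
    unfolding Units_def ring_mat_def by auto
  have "B - 1\<^sub>m n = (T * S) * (B - 1\<^sub>m n)" using T B by simp
  also have "\<dots> = T * (S * (B - 1\<^sub>m n))"
    using T S B by (intro assoc_mult_mat[of _ n n _ n _ n]) auto
  also have "S * (B - 1\<^sub>m n) = 0\<^sub>m n n"
    unfolding S(4) assms(4) by (rule eq_matI) auto
  also have "T * \<dots> = 0\<^sub>m n n" using T by simp
  finally have *: "B - 1\<^sub>m n = 0\<^sub>m n n" .
  show ?thesis
  proof (rule eq_matI)
    fix i j assume "i < dim_row (1\<^sub>m n)" "j < dim_col (1\<^sub>m n)"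
    then show "B $$ (i, j) = 1\<^sub>m n $$ (i, j)"
      using arg_cong[OF *, of "\<lambda>M. M $$ (i, j)"] B by simp
  qed (use B in auto)
qed

text \<open>This is the equality case of the triangle inequality: every real part is at most 1 and
  their sum is the number of terms, so each real part is 1, and norm 1 then leaves no imaginary
  part.\<close>

lemma sum_roots_of_unity_eq_card:
  fixes z :: "'i \<Rightarrow> complex"
  assumes "finite I" "\<And>i. i \<in> I \<Longrightarrow> norm (z i) = 1" "(\<Sum>i\<in>I. z i) = of_nat (card I)" "i \<in> I"
  shows "z i = 1"
proof -
  have le: "Re (z i) \<le> 1" if "i \<in> I" for i
    using assms(2)[OF that] complex_Re_le_cmod[of "z i"] by simp
  have "(\<Sum>i\<in>I. 1 - Re (z i)) = 0"
    using arg_cong[OF assms(3), of Re] by (simp add: sum_subtractf)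
  then have "Re (z i) = 1"
    using sum_nonneg_eq_0_iff[of I "\<lambda>i. 1 - Re (z i)"] le assms(1,4) by auto
  then show ?thesis
    using assms(2)[OF assms(4)] by (auto simp: complex_eq_iff cmod_def real_sqrt_eq_1_iff)
qed

text \<open>A Schur triangular form \<open>B\<close> of \<open>A\<close> also has finite order, so
  its diagonal consists of roots of unity. These add up to \<open>n\<close>, hence all equal 1, and
  a unitriangular matrix of finite order is the identity.\<close>

lemma finite_order_trace_imp_one:
  fixes A :: "complex mat"
  assumes A: "A \<in> carrier_mat n n" and pow: "A ^\<^sub>m m = 1\<^sub>m n" "m > 0"
    and tr: "trace_mat A = of_nat n"
  shows "A = 1\<^sub>m n"
proof -
  obtain es where "char_poly A = (\<Prod>a\<leftarrow>es. [:- a, 1:])"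
    using char_poly_factorized[OF A] by blast
  from schur_decomposition_exists[OF A this] obtain B P Q where
    B: "B \<in> carrier_mat n n" "upper_triangular B" and wit: "similar_mat_wit A B P Q"
    by (auto simp: similar_mat_def)
  note sim = similar_mat_witD2[OF A wit]
  have "B ^\<^sub>m m = Q * A ^\<^sub>m m * P"
    using similar_mat_wit_pow_id[OF similar_mat_wit_sym[OF wit]] .
  also have "\<dots> = 1\<^sub>m n" using pow sim by simp
  finally have Bm: "B ^\<^sub>m m = 1\<^sub>m n" .
  have "B $$ (i, i) ^ m = 1" if "i < n" for i
    using upper_triangular_pow[OF B, of m] Bm that by auto
  then have "norm (B $$ (i, i)) = 1" if "i < n" for i
    using that \<open>m > 0\<close> by (metis norm_one norm_power norm_ge_zero power_eq_1_iff less_numeral_extra(3))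
  moreover have "(\<Sum>i<n. B $$ (i, i)) = of_nat (card {..<n})"
    using tr trace_mat_similar[OF wit] B by (simp add: trace_mat_carrier)
  ultimately have "B $$ (i, i) = 1" if "i < n" for i
    using sum_roots_of_unity_eq_card[of "{..<n}" "\<lambda>i. B $$ (i, i)"] that by auto
  then have "B = 1\<^sub>m n"
    using unitriangular_pow_eq_one[OF B _ Bm pow(2)] by blast
  then show ?thesis using sim by simp
qed

section \<open>Representations, kernels and centers of characters\<close>

lemma GL_simps:
  "A \<otimes>\<^bsub>GL n\<^esub> B = A * B" "\<one>\<^bsub>GL n\<^esub> = 1\<^sub>m n"
  "carrier (GL n) = Units (ring_mat TYPE(complex) n ())"
  by (simp_all add: GL_def units_of_def ring_mat_simps)

lemma group_GL: "group (GL n)"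
proof -
  interpret R: ring "ring_mat TYPE(complex) n ()" by (rule ring_mat)
  show ?thesis unfolding GL_def by (rule R.units_group)
qed

text \<open>Invertibility is automatic: \<open>\<rho> (inv g)\<close> is a two-sided inverse of
  \<open>\<rho> g\<close>. Only size, multiplicativity and the value at the identity remain to be
  checked.\<close>

lemma representationI:
  fixes G (structure) and \<rho> :: "'a \<Rightarrow> complex mat"
  assumes "group G"
    and carrier: "\<And>g. g \<in> carrier G \<Longrightarrow> \<rho> g \<in> carrier_mat n n"
    and mult: "\<And>g h. g \<in> carrier G \<Longrightarrow> h \<in> carrier G \<Longrightarrow> \<rho> (g \<otimes> h) = \<rho> g * \<rho> h"
    and one: "\<rho> \<one> = 1\<^sub>m n"
  shows "representation G n \<rho>"
proof -
  interpret group G by fact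
  have "\<rho> g \<in> Units (ring_mat TYPE(complex) n ())" if g: "g \<in> carrier G" for g
  proof -
    have "\<rho> (inv g) * \<rho> g = 1\<^sub>m n" "\<rho> g * \<rho> (inv g) = 1\<^sub>m n"
      using g one by (simp_all flip: mult)
    then show ?thesis
      using carrier[OF g] carrier[of "inv g"] g by (auto simp: Units_def ring_mat_simps)
  qed
  then show ?thesis
    by (auto simp: representation_def hom_def GL_simps mult)
qed

lemma
  fixes G (structure)
  assumes "representation G n \<rho>"
  shows representation_carrier: "g \<in> carrier G \<Longrightarrow> \<rho> g \<in> carrier_mat n n"
    and representation_mult:
      "g \<in> carrier G \<Longrightarrow> h \<in> carrier G \<Longrightarrow> \<rho> (g \<otimes> h) = \<rho> g * \<rho> h"
  using assms by (auto simp: representation_def hom_def GL_simps Units_def ring_mat_simps)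

context group
begin

lemma representation_group_hom: "representation G n \<rho> \<Longrightarrow> group_hom G (GL n) \<rho>"
  by (simp add: representation_def group_hom_def group_hom_axioms_def group_GL is_group)

lemma representation_one: "representation G n \<rho> \<Longrightarrow> \<rho> \<one> = 1\<^sub>m n"
  using group_hom.hom_one[OF representation_group_hom] by (simp add: GL_simps)

lemma representation_pow:
  assumes "representation G n \<rho>" "g \<in> carrier G"
  shows "\<rho> (g [^] (k :: nat)) = \<rho> g ^\<^sub>m k"
proof (induction k)
  case 0
  then show ?case
    using representation_one[OF assms(1)] representation_carrier[OF assms] by simp
next
  case (Suc k)
  then show ?case using representation_mult[OF assms(1)] assms(2) by simp
qed

lemma representation_trace_imp_one:
  assumes "finite (carrier G)" "representation G n \<rho>" "g \<in> carrier G"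
    and "trace_mat (\<rho> g) = of_nat n"
  shows "\<rho> g = 1\<^sub>m n"
proof (rule finite_order_trace_imp_one)
  show "\<rho> g ^\<^sub>m Coset.order G = 1\<^sub>m n"
    using representation_pow[OF assms(2,3), of "Coset.order G"] pow_order_eq_1[OF assms(3)]
      representation_one[OF assms(2)] by simp
  show "Coset.order G > 0" using assms(1) order_gt_0_iff_finite by blast
qed (use assms representation_carrier in auto)

text \<open>The kernel is defined by character values alone. The value at the identity is the
  degree, and a matrix of finite order with that trace is the identity, so the kernel is that of the
  homomorphism into \<open>GL n\<close>.\<close>

lemma char_kernel_eq:
  assumes "finite (carrier G)" "representation G n \<rho>"
  shows "char_kernel G (character G \<rho>) = {g \<in> carrier G. \<rho> g = 1\<^sub>m n}"
proof -
  have "trace_mat (1\<^sub>m n :: complex mat) = of_nat n" by (simp add: trace_mat_def)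
  then have "trace_mat (\<rho> g) = of_nat n \<longleftrightarrow> \<rho> g = 1\<^sub>m n" if "g \<in> carrier G" for g
    using representation_trace_imp_one[OF assms that] by metis
  then show ?thesis
    using \<open>trace_mat (1\<^sub>m n) = of_nat n\<close> representation_one[OF assms(2)]
    by (simp add: char_kernel_def character_def cong: conj_cong)
qed

lemma char_kernel_normal:
  assumes "finite (carrier G)" "representation G n \<rho>"
  shows "char_kernel G (character G \<rho>) \<lhd> G"
  using group_hom.normal_kernel[OF representation_group_hom[OF assms(2)]]
  by (simp add: char_kernel_eq[OF assms] kernel_def GL_simps)

section \<open>Commutators and centers of characters\<close>

lemma commutator_closed [simp]:
  "g \<in> carrier G \<Longrightarrow> x \<in> carrier G \<Longrightarrow> commutator G g x \<in> carrier G"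
  by (simp add: commutator_def)

lemma commutator_eq_one_iff:
  assumes "g \<in> carrier G" "x \<in> carrier G"
  shows "commutator G g x = \<one> \<longleftrightarrow> g \<otimes> x = x \<otimes> g"
proof -
  have "commutator G g x = inv (x \<otimes> g) \<otimes> (g \<otimes> x)"
    using assms by (simp add: commutator_def inv_mult_group m_assoc)
  then have "commutator G g x = \<one> \<longleftrightarrow> \<one> = inv (x \<otimes> g) \<otimes> (g \<otimes> x)" by metis
  also have "\<dots> \<longleftrightarrow> g \<otimes> x = x \<otimes> g \<otimes> \<one>"
    using assms by (intro inv_solve_left) auto
  finally show ?thesis using assms by simp
qed

lemma commutator_set_subset_carrier: "g \<in> carrier G \<Longrightarrow> commutator_set G g \<subseteq> carrier G"
  by (auto simp: commutator_set_def)

lemma commutator_subgroup_subset_iff: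
  assumes "subgroup K G"
  shows "commutator_subgroup G g \<subseteq> K \<longleftrightarrow> (\<forall>x \<in> carrier G. commutator G g x \<in> K)"
proof
  assume "commutator_subgroup G g \<subseteq> K"
  then show "\<forall>x \<in> carrier G. commutator G g x \<in> K"
    by (auto simp: commutator_subgroup_def commutator_set_def intro: generate.incl)
next
  assume "\<forall>x \<in> carrier G. commutator G g x \<in> K"
  then have "commutator_set G g \<subseteq> K" by (auto simp: commutator_set_def)
  then show "commutator_subgroup G g \<subseteq> K"
    unfolding commutator_subgroup_def by (rule generate_subgroup_incl[OF _ assms])
qed

text \<open>The coset of \<open>g\<close> is central in the quotient iff every commutator of
  \<open>g\<close> becomes trivial there, that is, lies in the kernel. This is the bridge between
  the two sides of the theorem.\<close>

lemma char_center_iff: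
  assumes K: "char_kernel G \<chi> \<lhd> G" and g: "g \<in> carrier G"
  shows "g \<in> char_center G \<chi> \<longleftrightarrow> commutator_subgroup G g \<subseteq> char_kernel G \<chi>"
proof -
  let ?K = "char_kernel G \<chi>" and ?Q = "G Mod char_kernel G \<chi>"
  interpret N: normal ?K G by fact
  interpret Q: group ?Q by (rule N.factorgroup_is_group)
  interpret pi: group_hom G ?Q "\<lambda>x. ?K #> x"
    by unfold_locales (rule N.r_coset_hom_Mod)
  have ker: "?K #> y = \<one>\<^bsub>?Q\<^esub> \<longleftrightarrow> y \<in> ?K" if "y \<in> carrier G" for y
    using that N.rcos_const[of y] coset_join1[OF _ that N.is_subgroup]
    by (auto simp: FactGroup_def N.subset)
  have "commutator G g x \<in> ?K \<longleftrightarrow> (?K #> g) \<otimes>\<^bsub>?Q\<^esub> (?K #> x) = (?K #> x) \<otimes>\<^bsub>?Q\<^esub> (?K #> g)"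
    if x: "x \<in> carrier G" for x
  proof -
    have "commutator G g x \<in> ?K \<longleftrightarrow> ?K #> commutator G g x = \<one>\<^bsub>?Q\<^esub>"
      using ker g x by simp
    also have "?K #> commutator G g x = commutator ?Q (?K #> g) (?K #> x)"
      using g x by (simp add: commutator_def)
    finally show ?thesis
      using Q.commutator_eq_one_iff pi.hom_closed g x by simp
  qed
  then have "commutator_subgroup G g \<subseteq> ?K \<longleftrightarrow>
      (\<forall>x \<in> carrier G. (?K #> g) \<otimes>\<^bsub>?Q\<^esub> (?K #> x) = (?K #> x) \<otimes>\<^bsub>?Q\<^esub> (?K #> g))"
    by (simp add: commutator_subgroup_subset_iff N.is_subgroup)
  also have "\<dots> \<longleftrightarrow> ?K #> g \<in> center ?Q"
    using pi.hom_closed[OF g]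
    by (simp add: center_def carrier_FactGroup)
  finally show ?thesis using g by (simp add: char_center_def)
qed

section \<open>Normality of the commutator subgroup of an element\<close>

lemma inv_cancel:
  assumes "a \<in> carrier G" "b \<in> carrier G"
  shows "a \<otimes> (inv a \<otimes> b) = b" "inv a \<otimes> (a \<otimes> b) = b"
  using assms by (simp_all flip: m_assoc)

text \<open>A conjugate of a generator of \<open>[g,G]\<close> is again a product of a generator and
  the inverse of a generator, which is what makes \<open>[g,G]\<close> normal.\<close>

lemma commutator_conj:
  assumes "g \<in> carrier G" "x \<in> carrier G" "y \<in> carrier G"
  shows "y \<otimes> commutator G g x \<otimes> inv y =
    inv (commutator G g (inv y)) \<otimes> commutator G g (x \<otimes> inv y)"
  using assms by (simp add: commutator_def inv_mult_group m_assoc inv_cancel)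

lemma commutator_subgroup_normal:
  assumes g: "g \<in> carrier G"
  shows "commutator_subgroup G g \<lhd> G"
proof -
  let ?N = "commutator_subgroup G g"
  have N: "subgroup ?N G"
    unfolding commutator_subgroup_def
    by (rule generate_is_subgroup[OF commutator_set_subset_carrier[OF g]])
  have comm: "commutator G g x \<in> ?N" if "x \<in> carrier G" for x
    using that commutator_subgroup_subset_iff[OF N] by blast
  have "y \<otimes> n \<otimes> inv y \<in> ?N" if y: "y \<in> carrier G" and n: "n \<in> ?N" for y n
  proof -
    \<comment> \<open>The elements whose conjugate by \<open>y\<close> stays in \<open>?N\<close>
      form a subgroup. Since it contains all generators, it is the whole of
      \<open>?N\<close>.\<close>
    define M where "M = {n \<in> ?N. y \<otimes> n \<otimes> inv y \<in> ?N}"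
    have "subgroup M G"
    proof (rule subgroupI)
      show "M \<subseteq> carrier G" using subgroup.subset[OF N] by (auto simp: M_def)
      show "M \<noteq> {}" using subgroup.one_closed[OF N] y by (auto simp: M_def)
    next
      fix a assume "a \<in> M"
      then have a: "a \<in> ?N" "y \<otimes> a \<otimes> inv y \<in> ?N" "a \<in> carrier G"
        using subgroup.subset[OF N] by (auto simp: M_def)
      have "y \<otimes> inv a \<otimes> inv y = inv (y \<otimes> a \<otimes> inv y)"
        using a(3) y by (simp add: inv_mult_group m_assoc)
      then show "inv a \<in> M"
        using a subgroup.m_inv_closed[OF N] by (simp add: M_def)
    next
      fix a b assume "a \<in> M" "b \<in> M"
      then have ab: "a \<in> ?N" "y \<otimes> a \<otimes> inv y \<in> ?N" "a \<in> carrier G"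
        "b \<in> ?N" "y \<otimes> b \<otimes> inv y \<in> ?N" "b \<in> carrier G"
        using subgroup.subset[OF N] by (auto simp: M_def)
      have "y \<otimes> (a \<otimes> b) \<otimes> inv y = (y \<otimes> a \<otimes> inv y) \<otimes> (y \<otimes> b \<otimes> inv y)"
        using ab(3,6) y by (simp add: m_assoc inv_cancel)
      then show "a \<otimes> b \<in> M"
        using ab subgroup.m_closed[OF N] by (simp add: M_def)
    qed
    moreover have "commutator G g x \<in> M" if "x \<in> carrier G" for x
      using that y g comm subgroup.m_closed[OF N] subgroup.m_inv_closed[OF N]
      by (simp add: M_def commutator_conj)
    ultimately show ?thesis
      using commutator_subgroup_subset_iff[of M g] n by (auto simp: M_def)
  qed
  then show ?thesis using N by (simp add: normal_inv_iff)
qed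

end

section \<open>Separating a normal subgroup by an irreducible representation\<close>

lemma regular_representation_exists:
  fixes Q (structure)
  assumes "group Q" "finite (carrier Q)"
  shows "\<exists>n \<rho>. representation Q n \<rho> \<and> (\<forall>q \<in> carrier Q. \<rho> q = 1\<^sub>m n \<longrightarrow> q = \<one>)"
proof -
  interpret group Q by fact
  define n where "n = Coset.order Q"
  obtain f where "bij_betw f {0..<n} (carrier Q)"
    using ex_bij_betw_nat_finite[OF assms(2)] unfolding n_def Coset.order_def by blast
  then have f: "\<And>i. i < n \<Longrightarrow> f i \<in> carrier Q" "inj_on f {0..<n}" "f ` {0..<n} = carrier Q"
    by (auto simp: bij_betw_def)
  \<comment> \<open>The left regular representation: \<open>\<rho> q\<close> is the permutation
    matrix of left multiplication by \<open>q\<close>, with the group enumerated by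
    \<open>f\<close>.\<close>
  define \<rho> where "\<rho> q = mat n n (\<lambda>(i, j). if f i = q \<otimes> f j then 1 else 0 :: complex)" for q
  have "representation Q n \<rho>"
  proof (rule representationI[OF assms(1)])
    show "\<rho> \<one> = 1\<^sub>m n"
      using f by (intro eq_matI) (auto simp: \<rho>_def inj_on_eq_iff)
  next
    fix q r assume qr: "q \<in> carrier Q" "r \<in> carrier Q"
    show "\<rho> (q \<otimes> r) = \<rho> q * \<rho> r"
    proof (rule eq_matI)
      fix i j assume "i < dim_row (\<rho> q * \<rho> r)" "j < dim_col (\<rho> q * \<rho> r)"
      then have ij: "i < n" "j < n" by (auto simp: \<rho>_def)
      \<comment> \<open>The index \<open>l\<close> of \<open>r \<otimes> f j\<close> is the only one
        contributing to the entry of the product.\<close>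
      then have "r \<otimes> f j \<in> f ` {0..<n}" using f qr by simp
      then obtain l where l: "l < n" "f l = r \<otimes> f j" by auto
      have "(\<rho> q * \<rho> r) $$ (i, j) =
          (\<Sum>k = 0..<n. (if f i = q \<otimes> f k then 1 else 0) * (if f k = r \<otimes> f j then 1 else 0))"
        using ij by (simp add: \<rho>_def scalar_prod_def)
      also have "\<dots> = (\<Sum>k = 0..<n. if k = l then if f i = q \<otimes> f k then 1 else 0 else 0)"
        using f(2) l by (intro sum.cong) (auto simp: inj_on_eq_iff simp flip: l(2))
      also have "\<dots> = \<rho> (q \<otimes> r) $$ (i, j)"
        using l ij qr f(1) by (simp add: \<rho>_def m_assoc)
      finally show "\<rho> (q \<otimes> r) $$ (i, j) = (\<rho> q * \<rho> r) $$ (i, j)" by simp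
    qed (auto simp: \<rho>_def)
  qed (simp add: \<rho>_def)
  moreover have "q = \<one>" if q: "q \<in> carrier Q" and "\<rho> q = 1\<^sub>m n" for q
  proof -
    \<comment> \<open>Faithfulness already shows in one diagonal entry: if it is 1, left
      multiplication by \<open>q\<close> fixes \<open>f 0\<close>, so \<open>q\<close> is the
      identity.\<close>
    have "0 < n" using assms(2) order_gt_0_iff_finite by (simp add: n_def)
    then have "\<rho> q $$ (0, 0) = 1" using \<open>\<rho> q = 1\<^sub>m n\<close> by simp
    then have "f 0 = q \<otimes> f 0" using \<open>0 < n\<close> by (simp add: \<rho>_def split: if_splits)
    then show ?thesis using q f(1)[OF \<open>0 < n\<close>] r_cancel_one' by auto
  qed
  ultimately show ?thesis by blast
qed

text \<open>Pull a faithful representation of the quotient \<open>G Mod N\<close> back to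
  \<open>G\<close>; the coset of \<open>x\<close> is nontrivial because \<open>x\<close> lies
  outside \<open>N\<close>.\<close>

lemma (in group) representation_separating_normal:
  assumes "finite (carrier G)" "N \<lhd> G" "x \<in> carrier G" "x \<notin> N"
  shows "\<exists>n \<rho>. representation G n \<rho> \<and> (\<forall>y \<in> N. \<rho> y = 1\<^sub>m n) \<and> \<rho> x \<noteq> 1\<^sub>m n"
proof -
  interpret N: normal N G by fact
  interpret Q: group "G Mod N" by (rule N.factorgroup_is_group)
  have "finite (carrier (G Mod N))" using assms(1) by (simp add: carrier_FactGroup)
  then obtain n \<sigma> where \<sigma>: "representation (G Mod N) n \<sigma>"
    "\<And>q. q \<in> carrier (G Mod N) \<Longrightarrow> \<sigma> q = 1\<^sub>m n \<Longrightarrow> q = \<one>\<^bsub>G Mod N\<^esub>"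
    using regular_representation_exists[OF Q.is_group] by blast
  define \<rho> where "\<rho> = (\<lambda>y. \<sigma> (N #> y))"
  have "(\<lambda>y. N #> y) \<in> hom G (G Mod N)" by (rule N.r_coset_hom_Mod)
  then have "representation G n \<rho>"
    using \<sigma>(1) Group.hom_compose[of "\<lambda>y. N #> y" G "G Mod N" \<sigma> "GL n"]
    by (simp add: representation_def \<rho>_def comp_def)
  moreover have "\<rho> y = 1\<^sub>m n" if "y \<in> N" for y
    using that N.rcos_const Q.representation_one[OF \<sigma>(1)] by (simp add: \<rho>_def FactGroup_def)
  moreover have "\<rho> x \<noteq> 1\<^sub>m n"
  proof
    assume "\<rho> x = 1\<^sub>m n"
    moreover have "N #> x \<in> carrier (G Mod N)" using assms(3) by (simp add: carrier_FactGroup)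
    ultimately have "N #> x = N"
      using \<sigma>(2)[of "N #> x"] by (simp add: \<rho>_def FactGroup_def)
    then show False using coset_join1 N.subset assms(3,4) N.is_subgroup by blast
  qed
  ultimately show ?thesis by blast
qed

section \<open>Bases adapted to a subspace\<close>

lemma (in vec_space) li_extends_to_basis:
  assumes "A \<subseteq> carrier_vec n" "lin_indpt A"
  shows "\<exists>C. basis C \<and> finite C \<and> A \<subseteq> C"
proof -
  let ?P = "\<lambda>T. T \<subseteq> carrier_vec n \<and> lin_indpt T \<and> A \<subseteq> T"
  have "finite T \<and> card T \<le> dim" if "?P T" for T
    using that li_le_dim[OF fin_dim, of T] by simp
  then have "\<exists>C. finite C \<and> maximal C ?P"
    by (rule maximal_exists[where B = A]) (use assms in simp_all)
  then obtain C where C: "finite C" "maximal C ?P" by blast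
  \<comment> \<open>Any independent set above \<open>C\<close> contains \<open>A\<close> as well, so
    maximality among the sets containing \<open>A\<close> is maximality among all independent
    sets.\<close>
  then have "maximal C (\<lambda>T. T \<subseteq> carrier_vec n \<and> lin_indpt T)"
    unfolding maximal_def by (meson order_trans)
  then have "basis C" by (rule max_li_is_basis)
  moreover have "A \<subseteq> C" using C(2) by (simp only: maximal_def)
  ultimately show ?thesis using C(1) by blast
qed

text \<open>An independent subset of \<open>W\<close> that is maximal within \<open>W\<close> must
  span it, since a vector of \<open>W\<close> outside the span could be added. The dimension bounds
  the sizes, so a maximal one exists.\<close>

lemma (in vec_space) subspace_has_basis:
  assumes W: "VectorSpace.subspace class_ring W V"
  shows "\<exists>A. finite A \<and> A \<subseteq> W \<and> lin_indpt A \<and> span A = W"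
proof -
  have sub: "submodule class_ring W V" using W by (simp add: VectorSpace.subspace_def)
  have WC: "W \<subseteq> carrier_vec n" using submodule.subset[OF sub] by simp
  let ?P = "\<lambda>T. T \<subseteq> W \<and> lin_indpt T"
  have "lin_indpt {}" by (auto simp: lin_dep_def)
  then have "?P {}" by simp
  moreover have "finite T \<and> card T \<le> dim" if "?P T" for T
    using that WC li_le_dim[OF fin_dim, of T] by auto
  ultimately have "\<exists>A. finite A \<and> maximal A ?P"
    using maximal_exists[of ?P dim "{}"] by blast
  then obtain A where A: "finite A" "maximal A ?P" by blast
  note A_max = A(2)[unfolded maximal_def]
  from A(1) A_max have A: "finite A" "A \<subseteq> W" "lin_indpt A" by simp_all
  have max: "T = A" if "A \<subseteq> T" "T \<subseteq> W" "lin_indpt T" for T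
    using conjunct2[OF A_max, rule_format, of T] that by simp
  have "w \<in> span A" if w: "w \<in> W" for w
  proof (rule ccontr)
    assume w': "w \<notin> span A"
    then have "w \<notin> A" using A WC in_own_span[of A] by auto
    moreover have "lin_indpt (A \<union> {w})"
      using lin_dep_iff_in_span[of A w] A w w' WC \<open>w \<notin> A\<close> by auto
    ultimately show False using max[of "A \<union> {w}"] A w by auto
  qed
  moreover have "span A \<subseteq> W" using span_is_subset[OF A(2) sub] .
  ultimately show ?thesis using A by blast
qed

text \<open>The columns of \<open>P\<close> list a basis of \<open>W\<close> followed by vectors
  completing it to a basis of the whole space. The inverse \<open>Q\<close> computes coordinates in
  this basis, and those from index \<open>k\<close> on vanish on \<open>W\<close>.\<close>

lemma (in vec_space) subspace_adapted_basis:
  assumes W: "VectorSpace.subspace class_ring W V" "W \<noteq> {0\<^sub>v n}" "W \<noteq> carrier_vec n"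
  shows "\<exists>k P Q. 0 < k \<and> k < n \<and> P \<in> carrier_mat n n \<and> Q \<in> carrier_mat n n \<and>
    P * Q = 1\<^sub>m n \<and> Q * P = 1\<^sub>m n \<and> (\<forall>j<k. col P j \<in> W) \<and>
    (\<forall>w \<in> W. \<forall>i. k \<le> i \<and> i < n \<longrightarrow> (Q *\<^sub>v w) $ i = 0)"
proof -
  obtain A where A: "finite A" "A \<subseteq> W" "lin_indpt A" "span A = W"
    using subspace_has_basis[OF W(1)] by blast
  have sub: "submodule class_ring W V" using W by (simp add: VectorSpace.subspace_def)
  have AC: "A \<subseteq> carrier_vec n" using A submodule.subset[OF sub] by auto
  obtain C where C: "basis C" "finite C" "A \<subseteq> C"
    using li_extends_to_basis[OF AC A(3)] by blast
  have CC: "C \<subseteq> carrier_vec n" and Cli: "lin_indpt C" using C by (auto simp: basis_def)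
  have cardC: "card C = n" using dim_basis[OF C(2,1)] dim_is_n by simp
  define k where "k = card A"
  \<comment> \<open>Properness of \<open>W\<close> on both sides gives the strict bounds on
    \<open>k\<close>, so both diagonal blocks will have degree smaller than
    \<open>n\<close>.\<close>
  have "A \<noteq> {}" using A(4) W(2) span_empty by auto
  moreover have "A \<noteq> C"
    using A(4) W(3) C(1) by (auto simp: basis_def)
  ultimately have k: "0 < k" "k < n"
    using A(1) C psubset_card_mono[of C A] by (auto simp: k_def card_gt_0_iff simp flip: cardC)
  obtain as bs where as: "distinct as" "set as = A" and bs: "distinct bs" "set bs = C - A"
    using finite_distinct_list A(1) C(2) by (metis finite_Diff)
  have len: "length as = k" "length (as @ bs) = n"
    using as bs cardC C(2,3) by (auto simp: k_def card_Diff_subset finite_subset card_mono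
        simp flip: distinct_card)
  define P where "P = mat_of_cols n (as @ bs)"
  have P: "P \<in> carrier_mat n n" using len by (simp add: P_def carrier_matI)
  have cols: "cols P = as @ bs"
    using as bs AC CC by (simp add: P_def cols_mat_of_cols)
  then have dist: "distinct (cols P)" and set: "set (cols P) = C"
    using as bs C by auto
  have "det P \<noteq> 0"
    using lin_depI[OF P _ _ _ dist] det_0_iff_vec_prod_zero[OF P] Cli set by auto
  from det_non_zero_imp_unit[OF P this] obtain Q where
    Q: "Q \<in> carrier_mat n n" "P * Q = 1\<^sub>m n" "Q * P = 1\<^sub>m n"
    unfolding Units_def ring_mat_def by auto
  have col: "col P j = (as @ bs) ! j" if "j < n" for j
    using that P cols by (metis carrier_matD(2) cols_nth)
  have "col P j \<in> W" if "j < k" for j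
    using that k len as A by (auto simp: col nth_append)
  moreover have "(Q *\<^sub>v w) $ i = 0" if w: "w \<in> W" and i: "k \<le> i" "i < n" for w i
  proof -
    obtain a where a: "w = lincomb a A"
      using w A(1,4) AC finite_in_span[of A w] by auto
    \<comment> \<open>Extending the coefficients by zero writes \<open>w\<close> in the full basis
      \<open>C\<close>, with no contribution from the added vectors \<open>bs\<close>.\<close>
    define b where "b v = (if v \<in> A then a v else 0)" for v
    have "w = lincomb b A"
      unfolding a using AC by (intro lincomb_restrict) (auto simp: b_def)
    also have "\<dots> = lincomb b (A \<union> (C - A))"
      using A(1) C(2) AC CC by (intro lincomb_clean[symmetric]) (auto simp: b_def)
    also have "A \<union> (C - A) = C" using C(3) by blast
    finally have "w = lincomb b C" .
    then have "w = P *\<^sub>v vec n (\<lambda>i. b (col P i))"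
      using mat_mult_eq_lincomb[OF P dist, of b] set by simp
    then have "Q *\<^sub>v w = Q * P *\<^sub>v vec n (\<lambda>i. b (col P i))"
      using assoc_mult_mat_vec[OF Q(1) P] by simp
    also have "\<dots> = vec n (\<lambda>i. b (col P i))"
      unfolding Q(3) by simp
    finally have "Q *\<^sub>v w = vec n (\<lambda>i. b (col P i))" .
    moreover have "col P i \<in> set bs"
      using i len unfolding col[OF i(2)] by (simp add: nth_append)
    ultimately show ?thesis using i bs(2) by (simp add: b_def)
  qed
  ultimately show ?thesis
    using k P Q by (intro exI[of _ k] exI[of _ P] exI[of _ Q]) simp
qed

section \<open>Change of basis and diagonal blocks of representations\<close>

lemma mult_mat_inverse_cancel:
  fixes X :: "'a :: semiring_1 mat"
  assumes "P \<in> carrier_mat n n" "Q \<in> carrier_mat n n" "P * Q = 1\<^sub>m n" "X \<in> carrier_mat n m"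
  shows "P * (Q * X) = X"
  using assms by (simp flip: assoc_mult_mat[of P n n Q n X m])

lemma similar_representation:
  fixes G (structure)
  assumes "group G" and rep: "representation G n \<rho>"
    and PQ: "P \<in> carrier_mat n n" "Q \<in> carrier_mat n n" "P * Q = 1\<^sub>m n" "Q * P = 1\<^sub>m n"
  shows "representation G n (\<lambda>g. Q * \<rho> g * P)"
proof (rule representationI[OF assms(1)])
  interpret group G by fact
  show "Q * \<rho> \<one> * P = 1\<^sub>m n" using representation_one[OF rep] PQ by simp
  fix g h assume gh: "g \<in> carrier G" "h \<in> carrier G"
  note car = representation_carrier[OF rep]
  show "Q * \<rho> g * P \<in> carrier_mat n n" using car[OF gh(1)] PQ by auto
  show "Q * \<rho> (g \<otimes> h) * P = Q * \<rho> g * P * (Q * \<rho> h * P)"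
    using car[OF gh(1)] car[OF gh(2)] PQ
    by (simp add: representation_mult[OF rep gh] assoc_mult_mat[of _ n n _ n _ n]
        mult_mat_inverse_cancel[OF PQ(1-3), of _ n])
qed

text \<open>When the lower left block vanishes on the whole group, block multiplication multiplies
  the diagonal blocks separately. They are the actions on the invariant subspace spanned by the
  first \<open>k\<close> coordinates and on the quotient by it.\<close>

lemma block_triangular_representation:
  fixes G (structure)
  assumes "group G" and rep: "representation G n R" and k: "k \<le> n"
    and zero: "\<And>g i j. g \<in> carrier G \<Longrightarrow> k \<le> i \<Longrightarrow> i < n \<Longrightarrow> j < k \<Longrightarrow> R g $$ (i, j) = 0"
  shows "representation G k (\<lambda>g. mat k k (\<lambda>(i, j). R g $$ (i, j)))"
    and "representation G (n - k) (\<lambda>g. mat (n - k) (n - k) (\<lambda>(i, j). R g $$ (i + k, j + k)))"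
proof -
  interpret group G by fact
  have entry: "R (g \<otimes> h) $$ (i, j) = (\<Sum>l<n. R g $$ (i, l) * R h $$ (l, j))"
    if "g \<in> carrier G" "h \<in> carrier G" "i < n" "j < n" for g h i j
    using that representation_carrier[OF rep, of g] representation_carrier[OF rep, of h]
    by (auto simp: representation_mult[OF rep] scalar_prod_def lessThan_atLeast0 intro!: sum.cong)
  show "representation G k (\<lambda>g. mat k k (\<lambda>(i, j). R g $$ (i, j)))"
  proof (rule representationI[OF assms(1)])
    fix g h assume gh: "g \<in> carrier G" "h \<in> carrier G"
    \<comment> \<open>For the upper block the terms with k \<le> l drop out because of the second
      factor \<open>R h\<close>.\<close>
    have "R (g \<otimes> h) $$ (i, j) = (\<Sum>l = 0..<k. R g $$ (i, l) * R h $$ (l, j))"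
      if "i < k" "j < k" for i j
      unfolding entry[OF gh less_le_trans[OF that(1) k] less_le_trans[OF that(2) k]]
      using k that zero[OF gh(2)] by (intro sum.mono_neutral_right) auto
    then show "mat k k (\<lambda>(i, j). R (g \<otimes> h) $$ (i, j)) =
        mat k k (\<lambda>(i, j). R g $$ (i, j)) * mat k k (\<lambda>(i, j). R h $$ (i, j))"
      by (intro eq_matI) (auto simp: scalar_prod_def)
  next
    show "mat k k (\<lambda>(i, j). R \<one> $$ (i, j)) = 1\<^sub>m k"
      unfolding representation_one[OF rep] using k by (intro eq_matI) auto
  qed simp
  show "representation G (n - k) (\<lambda>g. mat (n - k) (n - k) (\<lambda>(i, j). R g $$ (i + k, j + k)))"
  proof (rule representationI[OF assms(1)])
    fix g h assume gh: "g \<in> carrier G" "h \<in> carrier G"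
    have "R (g \<otimes> h) $$ (i + k, j + k) =
        (\<Sum>l = 0..<n - k. R g $$ (i + k, l + k) * R h $$ (l + k, j + k))"
      if "i < n - k" "j < n - k" for i j
    proof -
      have "R (g \<otimes> h) $$ (i + k, j + k) = (\<Sum>l<n. R g $$ (i + k, l) * R h $$ (l, j + k))"
        using that by (intro entry gh) auto
      \<comment> \<open>For the lower block it is the first factor \<open>R g\<close> that kills the
        terms with \<open>l < k\<close>.\<close>
      also have "\<dots> = (\<Sum>l = k..<n. R g $$ (i + k, l) * R h $$ (l, j + k))"
        using that zero[OF gh(1)] by (intro sum.mono_neutral_right) auto
      also have "\<dots> = (\<Sum>l = 0..<n - k. R g $$ (i + k, l + k) * R h $$ (l + k, j + k))"
        using k sum.shift_bounds_nat_ivl[of _ 0 k "n - k"] by simp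
      finally show ?thesis .
    qed
    then show "mat (n - k) (n - k) (\<lambda>(i, j). R (g \<otimes> h) $$ (i + k, j + k)) =
        mat (n - k) (n - k) (\<lambda>(i, j). R g $$ (i + k, j + k)) *
        mat (n - k) (n - k) (\<lambda>(i, j). R h $$ (i + k, j + k))"
      by (intro eq_matI) (auto simp: scalar_prod_def)
  next
    show "mat (n - k) (n - k) (\<lambda>(i, j). R \<one> $$ (i + k, j + k)) = 1\<^sub>m (n - k)"
      unfolding representation_one[OF rep] by (intro eq_matI) auto
  qed simp
qed

lemma (in group) irreducible_separating_normal:
  assumes "finite (carrier G)" "N \<lhd> G" "x \<in> carrier G" "x \<notin> N"
  shows "\<exists>n \<rho>. irreducible_representation G n \<rho> \<and> (\<forall>y \<in> N. \<rho> y = 1\<^sub>m n) \<and> \<rho> x \<noteq> 1\<^sub>m n"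
proof -
  define sep where "sep n \<longleftrightarrow> (\<exists>\<rho>. representation G n \<rho> \<and> (\<forall>y \<in> N. \<rho> y = 1\<^sub>m n) \<and> \<rho> x \<noteq> 1\<^sub>m n)"
    for n
  define n where "n = (LEAST n. sep n)"
  have "\<exists>n. sep n"
    unfolding sep_def by (rule representation_separating_normal[OF assms])
  then have "sep n" unfolding n_def by (rule LeastI_ex)
  then obtain \<rho> where rep: "representation G n \<rho>" and \<rho>N: "\<And>y. y \<in> N \<Longrightarrow> \<rho> y = 1\<^sub>m n"
    and \<rho>x: "\<rho> x \<noteq> 1\<^sub>m n"
    unfolding sep_def by blast
  \<comment> \<open>Minimality of \<open>n\<close>: a representation of smaller degree that is
    trivial on \<open>N\<close> cannot separate \<open>x\<close> from \<open>N\<close>.\<close>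
  have min: "\<sigma> x = 1\<^sub>m m"
    if "m < n" "representation G m \<sigma>" "\<And>y. y \<in> N \<Longrightarrow> \<sigma> y = 1\<^sub>m m" for m \<sigma>
    using that not_less_Least[of m sep] unfolding n_def sep_def by blast
  \<comment> \<open>In degree 0 there is only one matrix, so \<open>\<rho> x\<close> would be the
    identity.\<close>
  have "n > 0"
    using \<rho>x representation_carrier[OF rep assms(3)] by (cases n) (auto intro!: eq_matI)
  moreover have "W = {0\<^sub>v n} \<or> W = carrier_vec n" if inv: "invariant_subspace G n \<rho> W" for W
  proof (rule ccontr)
    \<comment> \<open>By minimality \<open>x\<close> acts trivially on both \<open>W\<close> and the quotient by \<open>W\<close>, so \<open>\<rho> x\<close> has
      trace \<open>n\<close>; having finite order it is then the identity.\<close>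
    assume "\<not> (W = {0\<^sub>v n} \<or> W = carrier_vec n)"
    then obtain k P Q where k: "0 < k" "k < n"
      and PQ: "P \<in> carrier_mat n n" "Q \<in> carrier_mat n n" "P * Q = 1\<^sub>m n" "Q * P = 1\<^sub>m n"
      and P: "\<And>j. j < k \<Longrightarrow> col P j \<in> W"
      and Q: "\<And>w i. w \<in> W \<Longrightarrow> k \<le> i \<Longrightarrow> i < n \<Longrightarrow> (Q *\<^sub>v w) $ i = 0"
      using vec_space.subspace_adapted_basis[of W n] inv
      unfolding invariant_subspace_def by blast
    define R where "R g = Q * \<rho> g * P" for g
    have repR: "representation G n R"
      unfolding R_def by (rule similar_representation[OF is_group rep PQ])
    note carR = representation_carrier[OF repR]
    \<comment> \<open>Column \<open>j\<close> of \<open>R g\<close> holds the adapted coordinates of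
      \<open>\<rho> g *\<^sub>v col P j\<close>. This vector lies in \<open>W\<close> by invariance,
      so its coordinates from \<open>k\<close> on are zero.\<close>
    have zero: "R g $$ (i, j) = 0" if g: "g \<in> carrier G" and ij: "k \<le> i" "i < n" "j < k" for g i j
    proof -
      note car = representation_carrier[OF rep g]
      have "R g = Q * (\<rho> g * P)"
        using car PQ by (simp add: R_def assoc_mult_mat[of _ n n _ n _ n])
      also have "col \<dots> j = Q *\<^sub>v col (\<rho> g * P) j"
        using car PQ k ij by (intro col_mult2[of _ n n _ n]) auto
      also have "col (\<rho> g * P) j = \<rho> g *\<^sub>v col P j"
        using car PQ k ij by (intro col_mult2[of _ n n _ n]) auto
      finally have "col (R g) j = Q *\<^sub>v (\<rho> g *\<^sub>v col P j)" .
      moreover have "\<rho> g *\<^sub>v col P j \<in> W"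
        using P[OF ij(3)] inv g by (simp add: invariant_subspace_def)
      ultimately have "col (R g) j $ i = 0" using Q ij(1,2) by simp
      then show ?thesis using ij k carR[OF g] by simp
    qed
    let ?A = "\<lambda>g. mat k k (\<lambda>(i, j). R g $$ (i, j))"
      and ?D = "\<lambda>g. mat (n - k) (n - k) (\<lambda>(i, j). R g $$ (i + k, j + k))"
    have RN: "R y = 1\<^sub>m n" if "y \<in> N" for y
      using \<rho>N[OF that] PQ by (simp add: R_def)
    have A: "?A x = 1\<^sub>m k"
    proof (rule min[OF k(2)])
      show "representation G k ?A"
        by (rule block_triangular_representation(1)[OF is_group repR less_imp_le[OF k(2)] zero])
      show "?A y = 1\<^sub>m k" if "y \<in> N" for y
        unfolding RN[OF that] using k by (intro eq_matI) auto
    qed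
    have diag1: "R x $$ (i, i) = 1" if "i < k" for i
    proof -
      have "R x $$ (i, i) = ?A x $$ (i, i)" using that by simp
      also have "\<dots> = 1" unfolding A using that by simp
      finally show ?thesis .
    qed
    have D: "?D x = 1\<^sub>m (n - k)"
    proof (rule min)
      show "n - k < n" using k by simp
      show "representation G (n - k) ?D"
        by (rule block_triangular_representation(2)[OF is_group repR less_imp_le[OF k(2)] zero])
      show "?D y = 1\<^sub>m (n - k)" if "y \<in> N" for y
        unfolding RN[OF that] by (intro eq_matI) auto
    qed
    have diag2: "R x $$ (i + k, i + k) = 1" if "i < n - k" for i
    proof -
      have "R x $$ (i + k, i + k) = ?D x $$ (i, i)" using that by simp
      also have "\<dots> = 1" unfolding D using that by simp
      finally show ?thesis .
    qed
    have "R x $$ (i, i) = 1" if "i < n" for i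
      using that diag1[of i] diag2[of "i - k"] by (cases "i < k") auto
    then have "trace_mat (R x) = of_nat n"
      using carR[OF assms(3)] by (simp add: trace_mat_carrier)
    then have "R x = 1\<^sub>m n"
      by (rule representation_trace_imp_one[OF assms(1) repR assms(3)])
    \<comment> \<open>Undoing the change of basis makes \<open>\<rho> x\<close> the identity,
      against its choice.\<close>
    then have "P * (Q * \<rho> x * P) * Q = 1\<^sub>m n" using PQ by (simp add: R_def)
    moreover have "P * (Q * \<rho> x * P) * Q = \<rho> x"
      using representation_carrier[OF rep assms(3)] PQ
      by (simp add: assoc_mult_mat[of _ n n _ n _ n] mult_mat_inverse_cancel[OF PQ(1-3), of _ n])
    ultimately show False using \<rho>x by simp
  qed
  ultimately have "irreducible_representation G n \<rho>"
    using rep by (simp add: irreducible_representation_def)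
  then show ?thesis
    using \<rho>N \<rho>x by (intro exI[of _ n] exI[of _ \<rho>]) simp
qed

section \<open>Nested groups\<close>

context group
begin

text \<open>Take \<open>x\<close> in \<open>[h,G]\<close> but not in \<open>[g,G]\<close>, and an
  irreducible representation trivial on the normal subgroup \<open>[g,G]\<close> but not at
  \<open>x\<close>. Its kernel contains \<open>[g,G]\<close> and not \<open>[h,G]\<close>.\<close>

lemma char_center_separating:
  assumes fin: "finite (carrier G)" and g: "g \<in> carrier G" and h: "h \<in> carrier G"
    and not_sub: "\<not> commutator_subgroup G h \<subseteq> commutator_subgroup G g"
  shows "\<exists>\<chi> \<in> Irr G. g \<in> char_center G \<chi> \<and> h \<notin> char_center G \<chi>"
proof -
  let ?N = "commutator_subgroup G g"
  obtain x where x: "x \<in> commutator_subgroup G h" "x \<notin> ?N" using not_sub by blast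
  have N: "?N \<lhd> G" "commutator_subgroup G h \<lhd> G" by (simp_all add: commutator_subgroup_normal g h)
  have sub: "?N \<subseteq> carrier G" "commutator_subgroup G h \<subseteq> carrier G"
    using N by (auto dest: normal_imp_subgroup subgroup.subset)
  then have "x \<in> carrier G" using x by blast
  from irreducible_separating_normal[OF fin N(1) this x(2)] obtain n \<rho> where
    irr: "irreducible_representation G n \<rho>" and \<rho>: "\<forall>y \<in> ?N. \<rho> y = 1\<^sub>m n" "\<rho> x \<noteq> 1\<^sub>m n"
    by blast
  then have rep: "representation G n \<rho>" by (simp add: irreducible_representation_def)
  note iff = char_center_iff[OF char_kernel_normal[OF fin rep]]
  have "character G \<rho> \<in> Irr G" using irr by (auto simp: Irr_def)
  moreover have "g \<in> char_center G (character G \<rho>)"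
    unfolding iff[OF g] char_kernel_eq[OF fin rep] using \<rho> sub by auto
  moreover have "h \<notin> char_center G (character G \<rho>)"
    unfolding iff[OF h] char_kernel_eq[OF fin rep] using \<rho> x by auto
  ultimately show ?thesis by blast
qed

text \<open>All commutators of a central element are trivial. Hence an element whose commutator
  subgroup escapes some subgroup is noncentral.\<close>

lemma commutator_subgroup_central_subset:
  assumes "g \<in> center G" "subgroup K G"
  shows "commutator_subgroup G g \<subseteq> K"
  unfolding commutator_subgroup_subset_iff[OF assms(2)]
proof
  fix x assume "x \<in> carrier G"
  then have "commutator G g x = \<one>"
    using assms(1) commutator_eq_one_iff by (simp add: center_def)
  then show "commutator G g x \<in> K" using subgroup.one_closed[OF assms(2)] by simp
qed

end

theorem theorem1:
  fixes G :: "('a, 'b) monoid_scheme"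
  assumes "group G"
    and "finite (carrier G)"
    and "\<not> comm_group G"
  shows "nested G \<longleftrightarrow>
    (\<forall>g \<in> carrier G - center G. \<forall>h \<in> carrier G - center G.
       commutator_subgroup G g \<subseteq> commutator_subgroup G h \<or>
       commutator_subgroup G h \<subseteq> commutator_subgroup G g)"
proof -
  interpret group G by fact
  have normal: "char_kernel G \<chi> \<lhd> G" if "\<chi> \<in> Irr G" for \<chi>
    using that char_kernel_normal[OF assms(2)]
    by (auto simp: Irr_def irreducible_representation_def)
  let ?comp = "\<lambda>g h. commutator_subgroup G g \<subseteq> commutator_subgroup G h \<or>
    commutator_subgroup G h \<subseteq> commutator_subgroup G g"
  show ?thesis
  proof (intro iffI ballI)
    fix g h assume nested: "nested G" and "g \<in> carrier G - center G" "h \<in> carrier G - center G"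
    then have gh: "g \<in> carrier G" "h \<in> carrier G" by simp_all
    show "?comp g h"
    proof (rule ccontr)
      assume "\<not> ?comp g h"
      \<comment> \<open>Each failing inclusion yields a character, and the elements \<open>g\<close>
        and \<open>h\<close> witness that the two centers are incomparable.\<close>
      then obtain \<chi> \<psi> where "\<chi> \<in> Irr G" "g \<in> char_center G \<chi>" "h \<notin> char_center G \<chi>"
        and "\<psi> \<in> Irr G" "h \<in> char_center G \<psi>" "g \<notin> char_center G \<psi>"
        using char_center_separating[OF assms(2) gh] char_center_separating[OF assms(2) gh(2,1)]
        by auto
      then show False using nested unfolding nested_def by blast
    qed
  next
    assume chain: "\<forall>g \<in> carrier G - center G. \<forall>h \<in> carrier G - center G. ?comp g h"
    show "nested G"
      unfolding nested_def
    proof (intro ballI, rule ccontr)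
      fix \<chi> \<psi> assume \<chi>: "\<chi> \<in> Irr G" and \<psi>: "\<psi> \<in> Irr G"
        and "\<not> (char_center G \<chi> \<subseteq> char_center G \<psi> \<or> char_center G \<psi> \<subseteq> char_center G \<chi>)"
      then obtain g h where gh: "g \<in> char_center G \<chi>" "g \<notin> char_center G \<psi>"
        "h \<in> char_center G \<psi>" "h \<notin> char_center G \<chi>" by blast
      then have car: "g \<in> carrier G" "h \<in> carrier G" by (auto simp: char_center_def)
      note iff\<chi> = char_center_iff[OF normal[OF \<chi>]] and iff\<psi> = char_center_iff[OF normal[OF \<psi>]]
      have g: "commutator_subgroup G g \<subseteq> char_kernel G \<chi>"
          "\<not> commutator_subgroup G g \<subseteq> char_kernel G \<psi>"
        and h: "commutator_subgroup G h \<subseteq> char_kernel G \<psi>"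
          "\<not> commutator_subgroup G h \<subseteq> char_kernel G \<chi>"
        using gh iff\<chi>[OF car(1)] iff\<psi>[OF car(1)] iff\<chi>[OF car(2)] iff\<psi>[OF car(2)] by simp_all
      \<comment> \<open>The chain condition speaks only of noncentral elements; here each commutator
        subgroup escapes a kernel, which rules out centrality.\<close>
      have "g \<notin> center G" "h \<notin> center G"
        using g(2) h(2) commutator_subgroup_central_subset normal_imp_subgroup normal \<chi> \<psi>
        by blast+
      then have "?comp g h" using chain car by simp
      \<comment> \<open>Either inclusion would put the smaller commutator subgroup into the kernel
        that contains the larger one, which \<open>g\<close> and \<open>h\<close> exclude.\<close>
      then show False using g h by (meson order_trans)
    qed
  qed
qed

end
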